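(* Let $\mathcal{H}_1,\mathcal{H}_2$ be the Hilbert spaces of the two parts of a bipartite quantum system, let $\hat A,\hat A'$ be observables (self-adjoint operators) acting on $\mathcal{H}_1$ and $\hat B,\hat B'$ observables acting on $\mathcal{H}_2$, and let $\delta>0$. If the inequality $$\sigma_{AB}\,\sigma_{A'B'}\geqslant \delta$$ holds for all pure states of the bipartite system, then it holds for all states (including mixed states) of the bipartite system. The analogous statement holds in the multipartite case: if $N\geqslant 2$, $\hat A_i,\hat A_i'$ are observables acting on the $i$-th part $\mathcal{H}_i$ for $i=1,\dots,N$, and $\sigma_{A_1\ldots A_N}\,\sigma_{A'_1\ldots A'_N}\geqslant\delta$ for all pure states of the $N$-partite system, then the same inequality holds for all (pure or mixed) states of the $N$-partite system.
   Context: A state is a density operator $\varrho$ on the tensor product $\mathcal{H}_1\otimes\mathcal{H}_2$ (resp. $\mathcal{H}_1\otimes\cdots\otimes\mathcal{H}_N$), i.e. $\varrho=\sum_k p_k|\psi_k\rangle\langle\psi_k|$ with $p_k\geqslant0$, $\sum_k p_k=1$, and unit vectors $\psi_k$; it is pure if $\varrho=|\psi\rangle\langle\psi|$. For an observable $\hat X$ and a state, $\sigma_X=\sqrt{\langle\hat X^2\rangle-\langle\hat X\rangle^2}$ is the standard deviation, where $\langle\cdot\rangle$ is the expectation in the state (for $\varrho=\sum_k p_k|\psi_k\rangle\langle\psi_k|$ one has $\langle\hat X\rangle=\sum_k p_k\langle\psi_k|\hat X|\psi_k\rangle$ and $\langle\hat X^2\rangle=\sum_kp_k\|\hat X\psi_k\|^2$).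 $\sigma_{AB}$ denotes the standard deviation of $\hat A\otimes\hat B$, and $\sigma_{A_1\ldots A_N}$ that of $\hat A_1\otimes\cdots\otimes\hat A_N$. For unbounded observables, only states for which the second moments involved are finite are considered. *)

theory Defs
  imports "HOL-Analysis.Analysis"
begin

section \<open>Complex Hilbert spaces with explicit carriers\<close>

text \<open>
  Spaces are records with a carrier, so that the members of a finite family of Hilbert spaces
  need not be related to each other. The inner product is antilinear in its first argument.
\<close>

record 'a inner_space =
  vectors :: "'a set"
  vzero :: 'a
  vadd :: "'a \<Rightarrow> 'a \<Rightarrow> 'a"
  vscale :: "complex \<Rightarrow> 'a \<Rightarrow> 'a"
  cinner :: "'a \<Rightarrow> 'a \<Rightarrow> complex"

definition vnorm :: "'a inner_space \<Rightarrow> 'a \<Rightarrow> real" where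
  "vnorm H x = sqrt (Re (cinner H x x))"

text \<open>The value \<open>0\<close> off the carrier is needed because \<^locale>\<open>Metric_space\<close> requires
  nonnegativity and symmetry on the whole type.\<close>

definition vdist :: "'a inner_space \<Rightarrow> 'a \<Rightarrow> 'a \<Rightarrow> real" where
  "vdist H x y =
     (if x \<in> vectors H \<and> y \<in> vectors H then vnorm H (vadd H x (vscale H (- 1) y)) else 0)"

definition vtopology :: "'a inner_space \<Rightarrow> 'a topology" where
  "vtopology H = Metric_space.mtopology (vectors H) (vdist H)"

locale complex_inner_product_space =
  fixes H :: "'a inner_space"
  assumes vzero_closed: "vzero H \<in> vectors H"
    and vadd_closed: "\<lbrakk>x \<in> vectors H; y \<in> vectors H\<rbrakk> \<Longrightarrow> vadd H x y \<in> vectors H"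
    and vscale_closed: "x \<in> vectors H \<Longrightarrow> vscale H c x \<in> vectors H"
    and vadd_assoc: "\<lbrakk>x \<in> vectors H; y \<in> vectors H; z \<in> vectors H\<rbrakk>
          \<Longrightarrow> vadd H (vadd H x y) z = vadd H x (vadd H y z)"
    and vadd_commute: "\<lbrakk>x \<in> vectors H; y \<in> vectors H\<rbrakk> \<Longrightarrow> vadd H x y = vadd H y x"
    and vadd_vzero: "x \<in> vectors H \<Longrightarrow> vadd H x (vzero H) = x"
    and vadd_inverse: "x \<in> vectors H \<Longrightarrow> \<exists>y\<in>vectors H. vadd H x y = vzero H"
    and vscale_one: "x \<in> vectors H \<Longrightarrow> vscale H 1 x = x"
    and vscale_vscale: "x \<in> vectors H \<Longrightarrow> vscale H c (vscale H d x) = vscale H (c * d) x"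
    and vscale_add_left:
      "x \<in> vectors H \<Longrightarrow> vscale H (c + d) x = vadd H (vscale H c x) (vscale H d x)"
    and vscale_add_right: "\<lbrakk>x \<in> vectors H; y \<in> vectors H\<rbrakk>
          \<Longrightarrow> vscale H c (vadd H x y) = vadd H (vscale H c x) (vscale H c y)"
    and cinner_add_right: "\<lbrakk>x \<in> vectors H; y \<in> vectors H; z \<in> vectors H\<rbrakk>
          \<Longrightarrow> cinner H x (vadd H y z) = cinner H x y + cinner H x z"
    and cinner_scale_right: "\<lbrakk>x \<in> vectors H; y \<in> vectors H\<rbrakk>
          \<Longrightarrow> cinner H x (vscale H c y) = c * cinner H x y"
    and cinner_commute: "\<lbrakk>x \<in> vectors H; y \<in> vectors H\<rbrakk> \<Longrightarrow> cinner H y x = cnj (cinner H x y)"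
    and cinner_pos: "\<lbrakk>x \<in> vectors H; x \<noteq> vzero H\<rbrakk> \<Longrightarrow> 0 < Re (cinner H x x)"

locale hilbert_space = complex_inner_product_space +
  assumes complete: "Metric_space.mcomplete (vectors H) (vdist H)"

definition subspace_of :: "'a inner_space \<Rightarrow> 'a set \<Rightarrow> bool" where
  "subspace_of H V \<longleftrightarrow> V \<subseteq> vectors H \<and> vzero H \<in> V \<and>
     (\<forall>x\<in>V. \<forall>y\<in>V. vadd H x y \<in> V) \<and> (\<forall>c. \<forall>x\<in>V. vscale H c x \<in> V)"

definition lin_span :: "'a inner_space \<Rightarrow> 'a set \<Rightarrow> 'a set" where
  "lin_span H S = subspace_of H hull S"

definition direct_sum :: "'a inner_space \<Rightarrow> 'b inner_space \<Rightarrow> ('a \<times> 'b) inner_space" where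
  "direct_sum H K = \<lparr>
     vectors = vectors H \<times> vectors K,
     vzero = (vzero H, vzero K),
     vadd = (\<lambda>u v. (vadd H (fst u) (fst v), vadd K (snd u) (snd v))),
     vscale = (\<lambda>c u. (vscale H c (fst u), vscale K c (snd u))),
     cinner = (\<lambda>u v. cinner H (fst u) (fst v) + cinner K (snd u) (snd v)) \<rparr>"


section \<open>Observables\<close>

text \<open>
  A possibly unbounded operator is identified with its graph, a set of pairs; its domain is
  \<^const>\<open>Domain\<close> of that set.
\<close>

definition adjoint_graph :: "'a inner_space \<Rightarrow> ('a \<times> 'a) set \<Rightarrow> ('a \<times> 'a) set" where
  "adjoint_graph H A =
     {(x, y). x \<in> vectors H \<and> y \<in> vectors H \<and> (\<forall>(u, v)\<in>A. cinner H x v = cinner H y u)}"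

definition self_adjoint :: "'a inner_space \<Rightarrow> ('a \<times> 'a) set \<Rightarrow> bool" where
  "self_adjoint H A \<longleftrightarrow>
     subspace_of (direct_sum H H) A \<and> single_valued A \<and>
     vtopology H closure_of Domain A = vectors H \<and>
     adjoint_graph H A = A"

text \<open>Graphs of operators are single-valued, so this is \<open>A x\<close> for \<open>x\<close> in the domain.\<close>

definition op_apply :: "('a \<times> 'a) set \<Rightarrow> 'a \<Rightarrow> 'a" where
  "op_apply A x = (SOME y. (x, y) \<in> A)"


section \<open>Tensor products\<close>

text \<open>
  A Hilbert space tensor product is determined up to unitary equivalence by a bilinear
  (multilinear) map on the factors for which the inner product of elementary tensors is the
  product of the inner products and whose range spans a dense subspace.
\<close>

definition tensor_product2 ::
  "'a inner_space \<Rightarrow> 'b inner_space \<Rightarrow> 'c inner_space \<Rightarrow> ('a \<Rightarrow> 'b \<Rightarrow> 'c) \<Rightarrow> bool" where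
  "tensor_product2 H1 H2 T t \<longleftrightarrow>
     hilbert_space T \<and>
     (\<forall>x\<in>vectors H1. \<forall>y\<in>vectors H2. t x y \<in> vectors T) \<and>
     (\<forall>x\<in>vectors H1. \<forall>x'\<in>vectors H1. \<forall>y\<in>vectors H2.
        t (vadd H1 x x') y = vadd T (t x y) (t x' y)) \<and>
     (\<forall>x\<in>vectors H1. \<forall>y\<in>vectors H2. \<forall>y'\<in>vectors H2.
        t x (vadd H2 y y') = vadd T (t x y) (t x y')) \<and>
     (\<forall>c. \<forall>x\<in>vectors H1. \<forall>y\<in>vectors H2.
        t (vscale H1 c x) y = vscale T c (t x y) \<and> t x (vscale H2 c y) = vscale T c (t x y)) \<and>
     (\<forall>x\<in>vectors H1. \<forall>x'\<in>vectors H1. \<forall>y\<in>vectors H2. \<forall>y'\<in>vectors H2.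
        cinner T (t x y) (t x' y') = cinner H1 x x' * cinner H2 y y') \<and>
     vtopology T closure_of lin_span T {t x y | x y. x \<in> vectors H1 \<and> y \<in> vectors H2}
       = vectors T"

text \<open>For a family indexed by \<open>I\<close>, the map takes the extensional function \<open>(x\<^sub>i)\<close> to the
  elementary tensor of the \<open>x\<^sub>i\<close>.\<close>

definition tensor_product ::
  "'i set \<Rightarrow> ('i \<Rightarrow> 'a inner_space) \<Rightarrow> 'c inner_space \<Rightarrow> (('i \<Rightarrow> 'a) \<Rightarrow> 'c) \<Rightarrow> bool" where
  "tensor_product I H T t \<longleftrightarrow>
     hilbert_space T \<and>
     (\<forall>x\<in>(\<Pi>\<^sub>E i\<in>I. vectors (H i)). t x \<in> vectors T) \<and>
     (\<forall>x\<in>(\<Pi>\<^sub>E i\<in>I. vectors (H i)). \<forall>i\<in>I. \<forall>u\<in>vectors (H i). \<forall>v\<in>vectors (H i).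
        t (x(i := vadd (H i) u v)) = vadd T (t (x(i := u))) (t (x(i := v)))) \<and>
     (\<forall>x\<in>(\<Pi>\<^sub>E i\<in>I. vectors (H i)). \<forall>i\<in>I. \<forall>c. \<forall>u\<in>vectors (H i).
        t (x(i := vscale (H i) c u)) = vscale T c (t (x(i := u)))) \<and>
     (\<forall>x\<in>(\<Pi>\<^sub>E i\<in>I. vectors (H i)). \<forall>y\<in>(\<Pi>\<^sub>E i\<in>I. vectors (H i)).
        cinner T (t x) (t y) = (\<Prod>i\<in>I. cinner (H i) (x i) (y i))) \<and>
     vtopology T closure_of lin_span T (t ` (\<Pi>\<^sub>E i\<in>I. vectors (H i))) = vectors T"

text \<open>
  The tensor product of self-adjoint operators is the closure of the linear extension of
  \<open>x \<otimes> y \<mapsto> A x \<otimes> B y\<close> (\<open>x\<close>, \<open>y\<close> in the domains of \<open>A\<close>, \<open>B\<close>). That linear extension is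
  essentially self-adjoint, so its closure is again (the graph of) a self-adjoint operator.
\<close>

definition tensor_op2 ::
  "'c inner_space \<Rightarrow> ('a \<Rightarrow> 'b \<Rightarrow> 'c) \<Rightarrow> ('a \<times> 'a) set \<Rightarrow> ('b \<times> 'b) set \<Rightarrow> ('c \<times> 'c) set" where
  "tensor_op2 T t A B =
     vtopology (direct_sum T T) closure_of
       lin_span (direct_sum T T) {(t x y, t x' y') | x x' y y'. (x, x') \<in> A \<and> (y, y') \<in> B}"

definition tensor_op ::
  "'i set \<Rightarrow> 'c inner_space \<Rightarrow> (('i \<Rightarrow> 'a) \<Rightarrow> 'c) \<Rightarrow> ('i \<Rightarrow> ('a \<times> 'a) set) \<Rightarrow> ('c \<times> 'c) set" where
  "tensor_op I T t A =
     vtopology (direct_sum T T) closure_of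
       lin_span (direct_sum T T)
         {(t x, t x') | x x'.
            x \<in> extensional I \<and> x' \<in> extensional I \<and> (\<forall>i\<in>I. (x i, x' i) \<in> A i)}"


section \<open>States and standard deviations\<close>

primrec partial_vsum :: "'a inner_space \<Rightarrow> (nat \<Rightarrow> 'a) \<Rightarrow> nat \<Rightarrow> 'a" where
  "partial_vsum H f 0 = vzero H"
| "partial_vsum H f (Suc n) = vadd H (partial_vsum H f n) (f n)"

text \<open>\<open>\<rho> = |\<psi>\<rangle>\<langle>\<psi>|\<close> with a unit vector \<open>\<psi>\<close>\<close>

definition pure_state :: "'a inner_space \<Rightarrow> ('a \<Rightarrow> 'a) \<Rightarrow> 'a \<Rightarrow> bool" where
  "pure_state H \<rho> \<psi> \<longleftrightarrow> \<psi> \<in> vectors H \<and> vnorm H \<psi> = 1 \<and>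
     (\<forall>\<phi>\<in>vectors H. \<rho> \<phi> = vscale H (cinner H \<psi> \<phi>) \<psi>)"

text \<open>\<open>\<rho> = \<Sum>\<^sub>k p\<^sub>k |\<psi>\<^sub>k\<rangle>\<langle>\<psi>\<^sub>k|\<close>; finite mixtures are included, as weights may vanish.\<close>

definition mixed_state ::
  "'a inner_space \<Rightarrow> ('a \<Rightarrow> 'a) \<Rightarrow> (nat \<Rightarrow> real) \<Rightarrow> (nat \<Rightarrow> 'a) \<Rightarrow> bool" where
  "mixed_state H \<rho> p \<psi> \<longleftrightarrow>
     (\<forall>k. 0 \<le> p k) \<and> p sums 1 \<and> (\<forall>k. \<psi> k \<in> vectors H \<and> vnorm H (\<psi> k) = 1) \<and>
     (\<forall>\<phi>\<in>vectors H. limitin (vtopology H)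
        (partial_vsum H (\<lambda>k. vscale H (of_real (p k) * cinner H (\<psi> k) \<phi>) (\<psi> k)))
        (\<rho> \<phi>) sequentially)"

definition finite_second_moment ::
  "'a inner_space \<Rightarrow> ('a \<times> 'a) set \<Rightarrow> (nat \<Rightarrow> real) \<Rightarrow> (nat \<Rightarrow> 'a) \<Rightarrow> bool" where
  "finite_second_moment H X p \<psi> \<longleftrightarrow>
     (\<forall>k. p k \<noteq> 0 \<longrightarrow> \<psi> k \<in> Domain X) \<and>
     summable (\<lambda>k. p k * (vnorm H (op_apply X (\<psi> k)))\<^sup>2)"

definition second_moment ::
  "'a inner_space \<Rightarrow> ('a \<times> 'a) set \<Rightarrow> (nat \<Rightarrow> real) \<Rightarrow> (nat \<Rightarrow> 'a) \<Rightarrow> real" where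
  "second_moment H X p \<psi> = (\<Sum>k. p k * (vnorm H (op_apply X (\<psi> k)))\<^sup>2)"

text \<open>For self-adjoint \<open>X\<close> the number \<open>\<langle>\<psi>\<^sub>k|X\<psi>\<^sub>k\<rangle>\<close> is real; \<^const>\<open>Re\<close> only adjusts the type.\<close>

definition expectation ::
  "'a inner_space \<Rightarrow> ('a \<times> 'a) set \<Rightarrow> (nat \<Rightarrow> real) \<Rightarrow> (nat \<Rightarrow> 'a) \<Rightarrow> real" where
  "expectation H X p \<psi> = (\<Sum>k. p k * Re (cinner H (\<psi> k) (op_apply X (\<psi> k))))"

definition std_dev ::
  "'a inner_space \<Rightarrow> ('a \<times> 'a) set \<Rightarrow> (nat \<Rightarrow> real) \<Rightarrow> (nat \<Rightarrow> 'a) \<Rightarrow> real" where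
  "std_dev H X p \<psi> = sqrt (second_moment H X p \<psi> - (expectation H X p \<psi>)\<^sup>2)"

definition uncertainty_relation ::
  "'a inner_space \<Rightarrow> ('a \<times> 'a) set \<Rightarrow> ('a \<times> 'a) set \<Rightarrow> real \<Rightarrow>
     (nat \<Rightarrow> real) \<Rightarrow> (nat \<Rightarrow> 'a) \<Rightarrow> bool" where
  "uncertainty_relation H X Y \<delta> p \<psi> \<longleftrightarrow>
     (finite_second_moment H X p \<psi> \<and> finite_second_moment H Y p \<psi> \<longrightarrow>
        std_dev H X p \<psi> * std_dev H Y p \<psi> \<ge> \<delta>)"

text \<open>
  The moments of a state do not depend on how it is decomposed. A pure state is evaluated
  through its one-term decomposition, a general state through each of its decompositions.
\<close>

definition holds_for_pure_states ::
  "'a inner_space \<Rightarrow> ('a \<times> 'a) set \<Rightarrow> ('a \<times> 'a) set \<Rightarrow> real \<Rightarrow> bool" where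
  "holds_for_pure_states H X Y \<delta> \<longleftrightarrow>
     (\<forall>\<rho> \<psi>. pure_state H \<rho> \<psi> \<longrightarrow>
        uncertainty_relation H X Y \<delta> (\<lambda>k. if k = 0 then 1 else 0) (\<lambda>_. \<psi>))"

definition holds_for_all_states ::
  "'a inner_space \<Rightarrow> ('a \<times> 'a) set \<Rightarrow> ('a \<times> 'a) set \<Rightarrow> real \<Rightarrow> bool" where
  "holds_for_all_states H X Y \<delta> \<longleftrightarrow>
     (\<forall>\<rho> p \<psi>. mixed_state H \<rho> p \<psi> \<longrightarrow> uncertainty_relation H X Y \<delta> p \<psi>)"

end

theory Submission
  imports Defs
begin

text \<open>
  The variance of a mixture is the mean of the variances of its components plus the variance of
  their expectations, hence at least the mean of the variances. Applied to both observables, and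
  combined with the Cauchy--Schwarz inequality for the weights \<open>p\<^sub>k\<close>, this bounds the product
  of the standard deviations below by \<open>\<Sum>\<^sub>k p\<^sub>k \<sigma>\<^sub>k \<sigma>'\<^sub>k \<ge> \<Sum>\<^sub>k p\<^sub>k \<delta> = \<delta>\<close>.
\<close>

section \<open>Inner product spaces\<close>

context complex_inner_product_space
begin

section \<open>Vector space identities and the norm\<close>

lemma vadd_left_cancel:
  assumes "x \<in> vectors H" "y \<in> vectors H" "z \<in> vectors H" "vadd H x y = vadd H x z"
  shows "y = z"
proof -
  obtain w where w: "w \<in> vectors H" "vadd H x w = vzero H"
    using vadd_inverse assms(1) by blast
  have "u = vadd H w (vadd H x u)" if "u \<in> vectors H" for u
    by (metis that assms(1) w vadd_assoc vadd_commute vadd_vzero vzero_closed)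
  then show ?thesis using assms by metis
qed

lemma vscale_zero: "x \<in> vectors H \<Longrightarrow> vscale H 0 x = vzero H"
  by (metis add_0 vadd_left_cancel vadd_vzero vscale_add_left vscale_closed vzero_closed)

lemma vadd_vscale_minus_one: "x \<in> vectors H \<Longrightarrow> vadd H x (vscale H (- 1) x) = vzero H"
  by (metis add.right_inverse vscale_add_left vscale_one vscale_zero)

lemma cinner_vzero: "x \<in> vectors H \<Longrightarrow> cinner H x (vzero H) = 0"
  by (metis cinner_scale_right mult_zero_left vscale_zero)

lemma cinner_ge_zero: "x \<in> vectors H \<Longrightarrow> 0 \<le> Re (cinner H x x)"
  by (cases "x = vzero H") (auto simp: cinner_vzero dest: cinner_pos)

lemma vnorm_power2: "x \<in> vectors H \<Longrightarrow> (vnorm H x)\<^sup>2 = Re (cinner H x x)"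
  by (simp add: vnorm_def cinner_ge_zero)

lemma vnorm_ge_zero: "x \<in> vectors H \<Longrightarrow> 0 \<le> vnorm H x"
  by (simp add: vnorm_def cinner_ge_zero)

lemma vnorm_eq_zero_iff: "x \<in> vectors H \<Longrightarrow> vnorm H x = 0 \<longleftrightarrow> x = vzero H"
  using cinner_pos[of x] cinner_vzero[of x] by (cases "x = vzero H") (auto simp: vnorm_def)

lemma Re_cinner_commute:
  "\<lbrakk>x \<in> vectors H; y \<in> vectors H\<rbrakk> \<Longrightarrow> Re (cinner H y x) = Re (cinner H x y)"
  using cinner_commute[of x y] by simp

text \<open>As a quadratic polynomial in the real parameter \<open>s\<close>, this gives the
  Cauchy-Schwarz inequality at its minimum and the triangle inequality at
  \<open>s = 1\<close>.\<close>

lemma vnorm_vadd_scale_power2: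
  assumes "x \<in> vectors H" "y \<in> vectors H"
  shows "(vnorm H (vadd H x (vscale H (of_real s) y)))\<^sup>2 =
    (vnorm H x)\<^sup>2 + 2 * s * Re (cinner H x y) + s\<^sup>2 * (vnorm H y)\<^sup>2"
proof -
  define z where "z = vscale H (of_real s) y"
  have z: "z \<in> vectors H" using assms by (simp add: z_def vscale_closed)
  have w: "vadd H x z \<in> vectors H" using assms z by (simp add: vadd_closed)
  have uz: "Re (cinner H u z) = s * Re (cinner H u y)" if "u \<in> vectors H" for u
    using that assms by (simp add: z_def cinner_scale_right)
  \<comment> \<open>The axioms give additivity in the second argument; symmetry of the real part
    carries it over to the first.\<close>
  have "Re (cinner H (vadd H x z) (vadd H x z)) =
      Re (cinner H x (vadd H x z)) + Re (cinner H z (vadd H x z))"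
    using assms z w by (simp add: cinner_add_right Re_cinner_commute[of _ "vadd H x z"])
  also have "\<dots> = Re (cinner H x x) + 2 * Re (cinner H x z) + Re (cinner H z z)"
    using assms z by (simp add: cinner_add_right Re_cinner_commute[of x z])
  also have "\<dots> = Re (cinner H x x) + 2 * s * Re (cinner H x y) + s\<^sup>2 * Re (cinner H y y)"
    using assms z by (simp add: uz Re_cinner_commute[of y z] power2_eq_square)
  finally show ?thesis
    using assms z w by (simp add: vnorm_power2 flip: z_def)
qed

text \<open>The squared norm of \<open>x + s y\<close> is nonnegative for every real
  \<open>s\<close>. The bound on the real part is the form needed for \<open>expectation\<close>,
  which takes real parts.\<close>

lemma Cauchy_Schwarz:
  assumes "x \<in> vectors H" "y \<in> vectors H"
  shows "\<bar>Re (cinner H x y)\<bar> \<le> vnorm H x * vnorm H y"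
proof (cases "y = vzero H")
  case True
  then show ?thesis using assms by (simp add: cinner_vzero vnorm_ge_zero)
next
  case False
  define r n where "r = Re (cinner H x y)" and "n = (vnorm H y)\<^sup>2"
  have n: "n > 0" using False assms by (simp add: n_def vnorm_eq_zero_iff)
  \<comment> \<open>The value \<open>s = - r / n\<close> minimises the quadratic.\<close>
  have "0 \<le> (vnorm H x)\<^sup>2 + 2 * (- r / n) * r + (- r / n)\<^sup>2 * n"
    unfolding r_def n_def using vnorm_vadd_scale_power2[OF assms] by (metis zero_le_power2)
  also have "\<dots> = (vnorm H x)\<^sup>2 - r\<^sup>2 / n"
    using n by (simp add: power2_eq_square field_simps)
  finally have "r\<^sup>2 \<le> (vnorm H x * vnorm H y)\<^sup>2"
    using n by (simp add: field_simps power_mult_distrib flip: n_def)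
  then show ?thesis
    unfolding r_def using assms by (simp add: abs_le_square_iff[symmetric] vnorm_ge_zero)
qed

lemma vnorm_triangle:
  assumes "x \<in> vectors H" "y \<in> vectors H"
  shows "vnorm H (vadd H x y) \<le> vnorm H x + vnorm H y"
proof (rule power2_le_imp_le)
  show "(vnorm H (vadd H x y))\<^sup>2 \<le> (vnorm H x + vnorm H y)\<^sup>2"
    using vnorm_vadd_scale_power2[OF assms, of 1] Cauchy_Schwarz[OF assms] assms
    by (simp add: vscale_one power2_sum)
  show "0 \<le> vnorm H x + vnorm H y" using assms by (simp add: vnorm_ge_zero)
qed

section \<open>The metric induced by the norm\<close>

lemma vnorm_vscale_minus_one: "x \<in> vectors H \<Longrightarrow> vnorm H (vscale H (- 1) x) = vnorm H x"
  using cinner_commute[of x "vscale H (- 1) x"]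
  by (simp add: vnorm_def cinner_scale_right vscale_closed)

lemma vector_diff_self_eq_zero:
  assumes "x \<in> vectors H" "y \<in> vectors H"
  shows "vadd H x (vscale H (- 1) y) = vzero H \<longleftrightarrow> x = y"
proof
  assume "vadd H x (vscale H (- 1) y) = vzero H"
  then have "vadd H (vscale H (- 1) y) x = vadd H (vscale H (- 1) y) y"
    using assms vadd_vscale_minus_one[of y]
    by (simp add: vadd_commute[of "vscale H (- 1) y"] vscale_closed)
  then show "x = y" using vadd_left_cancel assms vscale_closed by blast
qed (use assms vadd_vscale_minus_one in simp)

text \<open>Telescoping of differences: it turns the triangle inequality of the norm into that of
  the metric.\<close>

lemma vector_diff_add:
  assumes "x \<in> vectors H" "y \<in> vectors H" "z \<in> vectors H"
  shows "vadd H (vadd H x (vscale H (- 1) y)) (vadd H y (vscale H (- 1) z)) =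
    vadd H x (vscale H (- 1) z)"
proof -
  let ?m = "vscale H (- 1)"
  have "vadd H (vadd H x (?m y)) (vadd H y (?m z)) = vadd H x (vadd H (vadd H (?m y) y) (?m z))"
    using assms by (simp add: vadd_assoc vadd_closed vscale_closed)
  also have "vadd H (?m y) y = vzero H"
    using assms vadd_vscale_minus_one[of y] by (simp add: vadd_commute[of "?m y"] vscale_closed)
  also have "vadd H (vzero H) (?m z) = ?m z"
    using assms vadd_vzero[of "?m z"]
    by (simp add: vadd_commute[of "vzero H"] vscale_closed vzero_closed)
  finally show ?thesis .
qed

lemma vector_diff_minus:
  assumes "x \<in> vectors H" "y \<in> vectors H"
  shows "vscale H (- 1) (vadd H x (vscale H (- 1) y)) = vadd H y (vscale H (- 1) x)"
  using assms
  by (simp add: vscale_add_right vscale_closed vscale_vscale vscale_one vadd_commute[of y])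

lemma Metric_space_vdist: "Metric_space (vectors H) (vdist H)"
proof
  fix x y z
  show "0 \<le> vdist H x y"
    by (simp add: vdist_def vnorm_ge_zero vadd_closed vscale_closed)
  show "vdist H x y = vdist H y x"
    using vector_diff_minus[of x y] vnorm_vscale_minus_one[of "vadd H x (vscale H (- 1) y)"]
    by (auto simp: vdist_def vadd_closed vscale_closed)
  assume x: "x \<in> vectors H" and y: "y \<in> vectors H"
  then show "vdist H x y = 0 \<longleftrightarrow> x = y"
    by (simp add: vdist_def vnorm_eq_zero_iff vector_diff_self_eq_zero vadd_closed vscale_closed)
  assume z: "z \<in> vectors H"
  show "vdist H x z \<le> vdist H x y + vdist H y z"
    using vnorm_triangle[of "vadd H x (vscale H (- 1) y)" "vadd H y (vscale H (- 1) z)"] x y z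
    by (simp add: vdist_def vector_diff_add vadd_closed vscale_closed)
qed

lemma topspace_vtopology: "topspace (vtopology H) = vectors H"
  by (simp add: vtopology_def Metric_space.topspace_mtopology[OF Metric_space_vdist])

end

section \<open>Direct sums and closures of graphs\<close>

lemma complex_inner_product_space_direct_sum:
  assumes "complex_inner_product_space H" "complex_inner_product_space K"
  shows "complex_inner_product_space (direct_sum H K)"
proof -
  interpret H: complex_inner_product_space H by fact
  interpret K: complex_inner_product_space K by fact
  show ?thesis
  proof
    fix u
    assume u: "u \<in> vectors (direct_sum H K)"
    obtain x y where
      "x \<in> vectors H" "vadd H (fst u) x = vzero H" "y \<in> vectors K" "vadd K (snd u) y = vzero K"
      using u H.vadd_inverse[of "fst u"] K.vadd_inverse[of "snd u"]
      by (auto simp: direct_sum_def mem_Times_iff)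
    then show "\<exists>v\<in>vectors (direct_sum H K). vadd (direct_sum H K) u v = vzero (direct_sum H K)"
      by (intro bexI[of _ "(x, y)"]) (auto simp: direct_sum_def)
  next
    fix u
    assume "u \<in> vectors (direct_sum H K)" "u \<noteq> vzero (direct_sum H K)"
    \<comment> \<open>One component is nonzero and contributes a positive term; the other
      contributes a nonnegative one.\<close>
    then show "0 < Re (cinner (direct_sum H K) u u)"
      using H.cinner_pos[of "fst u"] K.cinner_pos[of "snd u"]
        H.cinner_ge_zero[of "fst u"] K.cinner_ge_zero[of "snd u"]
      by (cases "fst u = vzero H"; cases "snd u = vzero K")
        (auto simp: direct_sum_def prod_eq_iff intro: add_pos_pos add_pos_nonneg add_nonneg_pos)
  next
    fix u v
    assume "u \<in> vectors (direct_sum H K)" "v \<in> vectors (direct_sum H K)"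
    then show "cinner (direct_sum H K) v u = cnj (cinner (direct_sum H K) u v)"
      using H.cinner_commute[of "fst u" "fst v"] K.cinner_commute[of "snd u" "snd v"]
      by (auto simp: direct_sum_def)
  next
    fix u v
    assume "u \<in> vectors (direct_sum H K)" "v \<in> vectors (direct_sum H K)"
    then show "vadd (direct_sum H K) u v = vadd (direct_sum H K) v u"
      using H.vadd_commute[of "fst u" "fst v"] K.vadd_commute[of "snd u" "snd v"]
      by (auto simp: direct_sum_def)
  qed (auto simp: direct_sum_def algebra_simps
    H.vzero_closed H.vadd_closed H.vscale_closed H.vadd_assoc H.vadd_vzero H.vscale_one
    H.vscale_vscale H.vscale_add_left H.vscale_add_right H.cinner_add_right H.cinner_scale_right
    K.vzero_closed K.vadd_closed K.vscale_closed K.vadd_assoc K.vadd_vzero K.vscale_one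
    K.vscale_vscale K.vscale_add_left K.vscale_add_right K.cinner_add_right K.cinner_scale_right)
qed

text \<open>A closure lies in the underlying space of the topology, here the pairs of vectors. Since
  tensor operators are defined as closures, this makes them relations on the vectors of the tensor
  product.\<close>

lemma closure_direct_sum_subset:
  assumes "complex_inner_product_space H"
  shows "vtopology (direct_sum H H) closure_of S \<subseteq> vectors H \<times> vectors H"
proof -
  interpret D: complex_inner_product_space "direct_sum H H"
    using assms by (rule complex_inner_product_space_direct_sum[OF _ assms])
  show ?thesis
    using closure_of_subset_topspace[of "vtopology (direct_sum H H)" S]
    by (simp add: D.topspace_vtopology) (simp add: direct_sum_def)
qed


section \<open>Variances of mixtures\<close>

text \<open>A finite second moment forces a finite first moment, because
  \<open>p k + p k * (m k)\<^sup>2\<close> dominates the series.\<close>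

lemma summable_weighted_first_moment:
  fixes p m :: "nat \<Rightarrow> real"
  assumes "\<And>k. 0 \<le> p k" "summable p" "summable (\<lambda>k. p k * (m k)\<^sup>2)"
  shows "summable (\<lambda>k. p k * m k)"
proof (rule summable_comparison_test)
  \<comment> \<open>Expanding the square of \<open>\<bar>m k\<bar> - 1\<close> even bounds twice the
    left-hand side.\<close>
  have "\<bar>m k\<bar> \<le> 1 + (m k)\<^sup>2" for k
    using zero_le_power2[of "\<bar>m k\<bar> - 1"] by (simp add: power2_diff)
  then have "norm (p k * m k) \<le> p k + p k * (m k)\<^sup>2" for k
    using mult_left_mono[of "\<bar>m k\<bar>" "1 + (m k)\<^sup>2" "p k"] assms(1)[of k]
    by (simp add: abs_mult algebra_simps)
  then show "\<exists>N. \<forall>k\<ge>N. norm (p k * m k) \<le> p k + p k * (m k)\<^sup>2" by blast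
  show "summable (\<lambda>k. p k + p k * (m k)\<^sup>2)" using assms by (intro summable_add)
qed

text \<open>The difference of the two sides is the variance of \<open>m\<close> under the weights
  \<open>p\<close>, a sum of nonnegative terms.\<close>

lemma weighted_mean_square_le:
  fixes p m :: "nat \<Rightarrow> real"
  assumes p: "\<And>k. 0 \<le> p k" "p sums 1" and m2: "summable (\<lambda>k. p k * (m k)\<^sup>2)"
  shows "(\<Sum>k. p k * m k)\<^sup>2 \<le> (\<Sum>k. p k * (m k)\<^sup>2)"
proof -
  define \<mu> where "\<mu> = (\<Sum>k. p k * m k)"
  have "(\<lambda>k. p k * m k) sums \<mu>"
    unfolding \<mu>_def using summable_weighted_first_moment[OF p(1) sums_summable[OF p(2)] m2]
    by (rule summable_sums)
  \<comment> \<open>The total weight 1 enters in the last term, so that the constants combine to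
    \<open>- \<mu>\<^sup>2\<close>.\<close>
  then have "(\<lambda>k. p k * (m k)\<^sup>2 - 2 * \<mu> * (p k * m k) + \<mu>\<^sup>2 * p k) sums
      ((\<Sum>k. p k * (m k)\<^sup>2) - 2 * \<mu> * \<mu> + \<mu>\<^sup>2 * 1)"
    by (intro sums_add sums_diff sums_mult summable_sums m2 p(2))
  moreover have "p k * (m k)\<^sup>2 - 2 * \<mu> * (p k * m k) + \<mu>\<^sup>2 * p k = p k * (m k - \<mu>)\<^sup>2" for k
    by (simp add: power2_diff algebra_simps)
  ultimately have "(\<lambda>k. p k * (m k - \<mu>)\<^sup>2) sums ((\<Sum>k. p k * (m k)\<^sup>2) - \<mu>\<^sup>2)"
    by (simp add: power2_eq_square)
  then have "0 \<le> (\<Sum>k. p k * (m k)\<^sup>2) - \<mu>\<^sup>2"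
    by (rule sums_le[OF _ sums_zero, rotated]) (simp add: p(1))
  then show ?thesis by (simp add: \<mu>_def)
qed

text \<open>Law of total variance with the variance of the means dropped. The bound on
  \<open>m\<close> is asked only where the weight is nonzero: a vector of weight zero may lie
  outside the domain of the observable, where \<open>op_apply\<close> is an arbitrary value. Partial
  sums on the left prepare for the finite Cauchy-Schwarz inequality.\<close>

lemma weighted_variance_le:
  fixes p m a :: "nat \<Rightarrow> real"
  assumes p: "\<And>k. 0 \<le> p k" "p sums 1"
    and a: "summable (\<lambda>k. p k * a k)" and le: "\<And>k. p k \<noteq> 0 \<Longrightarrow> (m k)\<^sup>2 \<le> a k"
  shows "(\<Sum>k<n. p k * (a k - (m k)\<^sup>2)) \<le> (\<Sum>k. p k * a k) - (\<Sum>k. p k * m k)\<^sup>2"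
proof -
  have pm: "p k * (m k)\<^sup>2 \<le> p k * a k" for k
    using p(1)[of k] le[of k] by (cases "p k = 0") (auto intro: mult_left_mono)
  have m2: "summable (\<lambda>k. p k * (m k)\<^sup>2)"
    using pm p(1) by (intro summable_comparison_test[OF _ a] exI[of _ 0]) simp
  have "(\<Sum>k<n. p k * (a k - (m k)\<^sup>2)) \<le> (\<Sum>k. p k * a k - p k * (m k)\<^sup>2)"
    unfolding right_diff_distrib
    by (rule sum_le_suminf) (use a m2 pm in \<open>auto intro: summable_diff\<close>)
  also have "\<dots> = (\<Sum>k. p k * a k) - (\<Sum>k. p k * (m k)\<^sup>2)"
    using a m2 by (rule suminf_diff[symmetric])
  finally show ?thesis
    using weighted_mean_square_le[OF p m2] by linarith
qed

lemma mixture_std_dev_product: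
  fixes p m a m' a' :: "nat \<Rightarrow> real"
  assumes p: "\<And>k. 0 \<le> p k" "p sums 1"
    and a: "summable (\<lambda>k. p k * a k)" and le: "\<And>k. p k \<noteq> 0 \<Longrightarrow> (m k)\<^sup>2 \<le> a k"
    and a': "summable (\<lambda>k. p k * a' k)" and le': "\<And>k. p k \<noteq> 0 \<Longrightarrow> (m' k)\<^sup>2 \<le> a' k"
    and \<delta>: "\<And>k. p k \<noteq> 0 \<Longrightarrow> \<delta> \<le> sqrt (a k - (m k)\<^sup>2) * sqrt (a' k - (m' k)\<^sup>2)"
  shows "\<delta> \<le> sqrt ((\<Sum>k. p k * a k) - (\<Sum>k. p k * m k)\<^sup>2) *
    sqrt ((\<Sum>k. p k * a' k) - (\<Sum>k. p k * m' k)\<^sup>2)" (is "\<delta> \<le> sqrt ?V * sqrt ?V'")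
proof (rule LIMSEQ_le_const2)
  \<comment> \<open>As the weights sum to 1, it is enough to bound every partial sum of
    \<open>p k * \<delta>\<close> by the product on the right.\<close>
  show "(\<lambda>n. \<Sum>k<n. p k * \<delta>) \<longlonglongrightarrow> \<delta>"
    using sums_mult2[OF p(2), of \<delta>] by (simp add: sums_def)
  have "(\<Sum>k<n. p k * \<delta>) \<le> sqrt ?V * sqrt ?V'" for n
  proof -
    \<comment> \<open>Each factor carries the square root of the weight, so
      \<open>f k * f' k\<close> is \<open>p k\<close> times the product of the two standard
      deviations of component \<open>k\<close>.\<close>
    define f where "f k = sqrt (p k * (a k - (m k)\<^sup>2))" for k
    define f' where "f' k = sqrt (p k * (a' k - (m' k)\<^sup>2))" for k
    have v: "0 \<le> p k * (a k - (m k)\<^sup>2)" "0 \<le> p k * (a' k - (m' k)\<^sup>2)" for k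
      using p(1)[of k] le[of k] le'[of k] by (cases "p k = 0"; simp)+
    have "p k * \<delta> \<le> \<bar>f k\<bar> * \<bar>f' k\<bar>" for k
    proof (cases "p k = 0")
      case False
      have "f k * f' k = p k * (sqrt (a k - (m k)\<^sup>2) * sqrt (a' k - (m' k)\<^sup>2))"
        using p(1)[of k] by (simp add: f_def f'_def real_sqrt_mult)
      then show ?thesis
        using mult_left_mono[OF \<delta>[OF False] p(1)] v[of k] by (simp add: f_def f'_def)
    qed simp
    then have "(\<Sum>k<n. p k * \<delta>) \<le> (\<Sum>k<n. \<bar>f k\<bar> * \<bar>f' k\<bar>)"
      by (intro sum_mono)
    also have "\<dots> \<le> L2_set f {..<n} * L2_set f' {..<n}"
      by (rule L2_set_mult_ineq)
    also have "\<dots> = sqrt (\<Sum>k<n. p k * (a k - (m k)\<^sup>2)) * sqrt (\<Sum>k<n. p k * (a' k - (m' k)\<^sup>2))"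
      using v by (simp add: L2_set_def f_def f'_def)
    also have "\<dots> \<le> sqrt ?V * sqrt ?V'"
    proof (rule mult_mono)
      \<comment> \<open>\<open>?V\<close> is at least a partial sum of weighted component variances,
        all of which are nonnegative.\<close>
      show "0 \<le> sqrt ?V"
        using order_trans[OF sum_nonneg weighted_variance_le[OF p a le, of n]] v by simp
      show "0 \<le> sqrt (\<Sum>k<n. p k * (a' k - (m' k)\<^sup>2))"
        using v by (simp add: sum_nonneg)
    qed (use weighted_variance_le[OF p a le, of n] weighted_variance_le[OF p a' le', of n] in simp_all)
    finally show ?thesis .
  qed
  then show "\<exists>N. \<forall>n\<ge>N. (\<Sum>k<n. p k * \<delta>) \<le> sqrt ?V * sqrt ?V'" by blast
qed


section \<open>From pure to mixed states\<close>

lemma op_apply_mem: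
  assumes "X \<subseteq> V \<times> V" "x \<in> Domain X"
  shows "op_apply X x \<in> V"
proof -
  have "(x, op_apply X x) \<in> X"
    using assms(2) unfolding op_apply_def by (metis DomainE someI_ex)
  then show ?thesis using assms(1) by blast
qed

lemma sums_one_term: "(\<lambda>k::nat. (if k = 0 then 1 else 0) * c) sums (c::real)"
  using sums_single[of 0 "\<lambda>_. c"] by (rule sums_cong[THEN iffD1, rotated]) simp

text \<open>The series collapse to their single nonzero term. The result has the form
  \<open>sqrt (a k - (m k)\<^sup>2)\<close> in which \<open>mixture_std_dev_product\<close> expects
  the components.\<close>

lemma std_dev_pure:
  "std_dev H X (\<lambda>k. if k = 0 then 1 else 0) (\<lambda>_. \<psi>) =
    sqrt ((vnorm H (op_apply X \<psi>))\<^sup>2 - (Re (cinner H \<psi> (op_apply X \<psi>)))\<^sup>2)"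
  unfolding std_dev_def second_moment_def expectation_def
  by (simp only: sums_unique[OF sums_one_term, symmetric])

lemma finite_second_moment_pure:
  "\<psi> \<in> Domain X \<Longrightarrow> finite_second_moment H X (\<lambda>k. if k = 0 then 1 else 0) (\<lambda>_. \<psi>)"
  unfolding finite_second_moment_def using sums_summable[OF sums_one_term] by simp

text \<open>This is \<open>mixture_std_dev_product\<close> with the squared norms of the images of
  \<open>\<psi> k\<close> as \<open>a k\<close> and the expectations in \<open>\<psi> k\<close> as
  \<open>m k\<close>. It treats arbitrary relations on one space, so the bipartite and the
  multipartite claim are both instances.\<close>

lemma uncertainty_pure_to_mixed:
  assumes H: "complex_inner_product_space H"
    and X: "X \<subseteq> vectors H \<times> vectors H" and Y: "Y \<subseteq> vectors H \<times> vectors H"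
    and pure: "holds_for_pure_states H X Y \<delta>"
  shows "holds_for_all_states H X Y \<delta>"
  unfolding holds_for_all_states_def uncertainty_relation_def
proof (intro allI impI)
  interpret complex_inner_product_space H by fact
  fix \<rho> p \<psi>
  assume mixed: "mixed_state H \<rho> p \<psi>"
    and fin: "finite_second_moment H X p \<psi> \<and> finite_second_moment H Y p \<psi>"
  have p: "\<And>k. 0 \<le> p k" "p sums 1" and \<psi>: "\<And>k. \<psi> k \<in> vectors H" "\<And>k. vnorm H (\<psi> k) = 1"
    using mixed by (auto simp: mixed_state_def)
  have dom: "\<psi> k \<in> Domain X" "\<psi> k \<in> Domain Y" if "p k \<noteq> 0" for k
    using fin that by (auto simp: finite_second_moment_def)
  \<comment> \<open>Cauchy-Schwarz against the unit vector \<open>\<psi> k\<close> makes each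
    component variance nonnegative.\<close>
  have mean_le: "(Re (cinner H (\<psi> k) (op_apply Z (\<psi> k))))\<^sup>2 \<le> (vnorm H (op_apply Z (\<psi> k)))\<^sup>2"
    if "Z \<subseteq> vectors H \<times> vectors H" "\<psi> k \<in> Domain Z" for Z k
    using Cauchy_Schwarz[OF \<psi>(1) op_apply_mem[OF that], of k] \<psi>(2)
    by (simp add: abs_le_square_iff[symmetric])
  show "\<delta> \<le> std_dev H X p \<psi> * std_dev H Y p \<psi>"
    unfolding std_dev_def second_moment_def expectation_def
  proof (rule mixture_std_dev_product[OF p])
    fix k
    assume k: "p k \<noteq> 0"
    \<comment> \<open>The projection onto \<open>\<psi> k\<close> is a pure state to which the
      hypothesis applies: with nonzero weight, \<open>\<psi> k\<close> lies in both domains, so its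
      second moments are finite.\<close>
    have "pure_state H (\<lambda>\<phi>. vscale H (cinner H (\<psi> k) \<phi>) (\<psi> k)) (\<psi> k)"
      using \<psi> by (simp add: pure_state_def)
    then show "\<delta> \<le> sqrt ((vnorm H (op_apply X (\<psi> k)))\<^sup>2 - (Re (cinner H (\<psi> k) (op_apply X (\<psi> k))))\<^sup>2) *
        sqrt ((vnorm H (op_apply Y (\<psi> k)))\<^sup>2 - (Re (cinner H (\<psi> k) (op_apply Y (\<psi> k))))\<^sup>2)"
      using pure finite_second_moment_pure[OF dom(1)[OF k]] finite_second_moment_pure[OF dom(2)[OF k]]
      unfolding holds_for_pure_states_def uncertainty_relation_def std_dev_pure[symmetric] by metis
  next
    show "summable (\<lambda>k. p k * (vnorm H (op_apply X (\<psi> k)))\<^sup>2)"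
      and "summable (\<lambda>k. p k * (vnorm H (op_apply Y (\<psi> k)))\<^sup>2)"
      using fin by (simp_all add: finite_second_moment_def)
  qed (simp_all add: mean_le X Y dom)
qed

theorem theorem1:
  fixes \<delta> :: real
    and H1 :: "'a inner_space" and H2 :: "'b inner_space" and T2 :: "'c inner_space"
    and t2 :: "'a \<Rightarrow> 'b \<Rightarrow> 'c"
    and A A' :: "('a \<times> 'a) set" and B B' :: "('b \<times> 'b) set"
    and N :: nat
    and H :: "nat \<Rightarrow> 'd inner_space" and T :: "'e inner_space"
    and t :: "(nat \<Rightarrow> 'd) \<Rightarrow> 'e"
    and C C' :: "nat \<Rightarrow> ('d \<times> 'd) set"
  assumes "\<delta> > 0"
  shows
    "(hilbert_space H1 \<and> hilbert_space H2 \<and> tensor_product2 H1 H2 T2 t2 \<and>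
        self_adjoint H1 A \<and> self_adjoint H1 A' \<and> self_adjoint H2 B \<and> self_adjoint H2 B' \<and>
        holds_for_pure_states T2 (tensor_op2 T2 t2 A B) (tensor_op2 T2 t2 A' B') \<delta>
      \<longrightarrow> holds_for_all_states T2 (tensor_op2 T2 t2 A B) (tensor_op2 T2 t2 A' B') \<delta>)
     \<and>
     (N \<ge> 2 \<and> (\<forall>i\<in>{1..N}. hilbert_space (H i)) \<and> tensor_product {1..N} H T t \<and>
        (\<forall>i\<in>{1..N}. self_adjoint (H i) (C i) \<and> self_adjoint (H i) (C' i)) \<and>
        holds_for_pure_states T (tensor_op {1..N} T t C) (tensor_op {1..N} T t C') \<delta>
      \<longrightarrow> holds_for_all_states T (tensor_op {1..N} T t C) (tensor_op {1..N} T t C') \<delta>)"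
proof (intro conjI impI; elim conjE)
  assume T2: "tensor_product2 H1 H2 T2 t2"
    and pure: "holds_for_pure_states T2 (tensor_op2 T2 t2 A B) (tensor_op2 T2 t2 A' B') \<delta>"
  have "complex_inner_product_space T2"
    using T2 by (simp add: tensor_product2_def hilbert_space_def)
  \<comment> \<open>Both product observables are closures in \<open>direct_sum T2 T2\<close>, hence
    relations on the vectors of \<open>T2\<close>.\<close>
  then show "holds_for_all_states T2 (tensor_op2 T2 t2 A B) (tensor_op2 T2 t2 A' B') \<delta>"
    using pure unfolding tensor_op2_def
    by (intro uncertainty_pure_to_mixed closure_direct_sum_subset)
next
  assume T: "tensor_product {1..N} H T t"
    and pure: "holds_for_pure_states T (tensor_op {1..N} T t C) (tensor_op {1..N} T t C') \<delta>"
  have "complex_inner_product_space T"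
    using T by (simp add: tensor_product_def hilbert_space_def)
  then show "holds_for_all_states T (tensor_op {1..N} T t C) (tensor_op {1..N} T t C') \<delta>"
    using pure unfolding tensor_op_def
    by (intro uncertainty_pure_to_mixed closure_direct_sum_subset)
qed

end
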